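(* Let $P\subset\mathbb{R}^6$ be the $7$-element set consisting of a vertex of a $6$-dimensional cube together with its $6$ adjacent vertices (e.g. the origin and the $6$ standard unit vectors $e_1,\dots,e_6$). Then $P$ is not diameter-Ramsey.
   Context: For a finite set $X$ in a Euclidean space, $\mathrm{diam}(X)$ denotes the largest Euclidean distance between two points of $X$. Two point sets are congruent if there is an isometry mapping one onto the other. A finite set $P$ of points in a Euclidean space is called diameter-Ramsey if for every integer $r\ge 2$ there exist an integer $d=d(P,r)$ and a finite set $R\subset\mathbb{R}^d$ with $\mathrm{diam}(R)=\mathrm{diam}(P)$ such that for every coloring of the points of $R$ with $r$ colors there is a monochromatic subset of $R$ congruent to $P$. *)

theory Defs
  imports "HOL-Analysis.Analysis"
begin

text \<open>
  The dimension of the space containing \<open>R\<close> is existentially quantified in the definition of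
  diameter-Ramsey sets, so it cannot be a type. Points of \<open>\<real>\<^sup>d\<close> are therefore the members of
  \<^term>\<open>topspace (Euclidean_space d)\<close>, i.e. functions vanishing at all indices \<open>\<ge> d\<close>.
  The overloaded \<^const>\<open>dist\<close> on \<^typ>\<open>nat \<Rightarrow> real\<close> metrizes the product topology and is
  \<^emph>\<open>not\<close> the Euclidean distance; hence the explicit distance below and the notions
  parametrized by a distance function.
\<close>

definition edist :: "nat \<Rightarrow> (nat \<Rightarrow> real) \<Rightarrow> (nat \<Rightarrow> real) \<Rightarrow> real" where
  "edist d x y = L2_set (\<lambda>i. x i - y i) {..<d}"

definition diam_wrt :: "('a \<Rightarrow> 'a \<Rightarrow> real) \<Rightarrow> 'a set \<Rightarrow> real" where
  "diam_wrt \<delta> X = Max {\<delta> x y | x y. x \<in> X \<and> y \<in> X}"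

definition congruent_wrt ::
  "('a \<Rightarrow> 'a \<Rightarrow> real) \<Rightarrow> 'a set \<Rightarrow> ('b \<Rightarrow> 'b \<Rightarrow> real) \<Rightarrow> 'b set \<Rightarrow> bool" where
  "congruent_wrt \<delta> A \<delta>' B \<longleftrightarrow>
     (\<exists>f. bij_betw f A B \<and> (\<forall>x\<in>A. \<forall>y\<in>A. \<delta>' (f x) (f y) = \<delta> x y))"

definition diameter_Ramsey :: "'a::euclidean_space set \<Rightarrow> bool" where
  "diameter_Ramsey P \<longleftrightarrow> finite P \<and>
     (\<forall>r\<ge>2. \<exists>d R. finite R \<and> R \<subseteq> topspace (Euclidean_space d) \<and>
        diam_wrt (edist d) R = diam_wrt dist P \<and>
        (\<forall>c \<in> R \<rightarrow> {..<r::nat}. \<exists>Q\<subseteq>R.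
           (\<exists>k. \<forall>x\<in>Q. c x = k) \<and> congruent_wrt dist P (edist d) Q))"

text \<open>
  A cube in \<open>\<real>\<^sup>n\<close> is given by a base vertex \<open>a\<close> and \<open>n\<close> pairwise orthogonal edge vectors
  \<open>w i\<close> of a common positive length; its \<open>2\<^sup>n\<close> vertices are indexed by the sets of edge
  vectors added to \<open>a\<close>, and its edges join index sets differing in exactly one element.
\<close>

definition cube_frame :: "('n \<Rightarrow> real ^ 'n::finite) \<Rightarrow> bool" where
  "cube_frame w \<longleftrightarrow>
     (\<exists>s>0. \<forall>i. norm (w i) = s) \<and> (\<forall>i j. i \<noteq> j \<longrightarrow> orthogonal (w i) (w j))"

definition cube_vertex :: "real ^ 'n \<Rightarrow> ('n \<Rightarrow> real ^ 'n) \<Rightarrow> 'n set \<Rightarrow> real ^ 'n::finite" where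
  "cube_vertex a w S = a + (\<Sum>i\<in>S. w i)"

definition cube_adjacent ::
  "real ^ 'n \<Rightarrow> ('n \<Rightarrow> real ^ 'n) \<Rightarrow> real ^ 'n \<Rightarrow> real ^ 'n::finite \<Rightarrow> bool" where
  "cube_adjacent a w u v \<longleftrightarrow>
     (\<exists>S i. i \<notin> S \<and> {u, v} = {cube_vertex a w S, cube_vertex a w (insert i S)})"

lemma cube_frame_axis: "cube_frame (\<lambda>i. axis i 1)"
  by (auto simp: cube_frame_def orthogonal_def inner_axis_axis)

lemma standard_cube_corner:
  "{u. cube_adjacent 0 (\<lambda>i. axis i 1) (0 :: real ^ 'n::finite) u} = range (\<lambda>i. axis i 1)"
proof -
  have comp: "cube_vertex 0 (\<lambda>i. axis i 1) S $ j = (if j \<in> S then 1 else 0)"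
    for S and j :: 'n
    by (simp add: cube_vertex_def axis_def if_distrib cong: if_cong)
  have zero: "cube_vertex 0 (\<lambda>i. axis i 1) S = (0 :: real ^ 'n) \<longleftrightarrow> S = {}" for S
    by (auto simp: vec_eq_iff comp split: if_splits)
  have single: "cube_vertex 0 (\<lambda>i. axis i 1) {i} = (axis i 1 :: real ^ 'n)" for i
    by (simp add: cube_vertex_def)
  show ?thesis
  proof (intro equalityI subsetI)
    fix u :: "real ^ 'n"
    assume "u \<in> {u. cube_adjacent 0 (\<lambda>i. axis i 1) 0 u}"
    then obtain S i where
      "{0, u} = {cube_vertex 0 (\<lambda>i. axis i 1) S, cube_vertex 0 (\<lambda>i. axis i 1) (insert i S)}"
      by (auto simp: cube_adjacent_def)
    then have "cube_vertex 0 (\<lambda>i. axis i 1) S = (0 :: real ^ 'n)"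
      and "u = cube_vertex 0 (\<lambda>i. axis i 1) (insert i S)"
      using zero[of "insert i S"] by (auto simp: doubleton_eq_iff)
    then show "u \<in> range (\<lambda>i. axis i 1)"
      using zero[of S] single by auto
  next
    fix u :: "real ^ 'n"
    assume "u \<in> range (\<lambda>i. axis i 1)"
    then obtain i where "u = axis i 1" by auto
    then have "{0, u} = {cube_vertex 0 (\<lambda>i. axis i 1) {}, cube_vertex 0 (\<lambda>i. axis i 1) {i}}"
      using zero[of "{}"] single[of i] by simp
    then show "u \<in> {u. cube_adjacent 0 (\<lambda>i. axis i 1) 0 u}"
      unfolding cube_adjacent_def by blast
  qed
qed

end

theory Submission
  imports Defs
begin

text \<open>
  Let \<open>P\<close> have edge length \<open>s\<close>, so that its diameter is \<open>D = s \<surd>2\<close> while its squared circumradius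
  is \<open>6 s\<^sup>2 / 4 = 3 D\<^sup>2 / 4\<close>. A weak form of Jung's theorem puts every finite set \<open>R\<close> of diameter
  \<open>D\<close>, in any dimension, into a ball of squared radius \<open>7 D\<^sup>2 / 10\<close> about some point \<open>z\<close>. Colour
  \<open>R\<close> by the squared distance to \<open>z\<close>, rounded to a multiple of \<open>3 s\<^sup>2 / 100\<close>; this needs only
  boundedly many colours. The points of a monochromatic copy of \<open>P\<close> are almost equidistant from
  \<open>z\<close>, so their distance to \<open>z\<close> is nearly at least the circumradius of \<open>P\<close>, which is too large.
\<close>

section \<open>Stewart's identity and enclosing balls\<close>

lemma edist_nonneg: "0 \<le> edist d x y"
  by (simp add: edist_def)

lemma edist_power2: "(edist d x y)\<^sup>2 = (\<Sum>k<d. (x k - y k)\<^sup>2)"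
  by (simp add: edist_def L2_set_def sum_nonneg)

lemma edist_commute: "edist d x y = edist d y x"
  by (simp add: edist_def L2_set_def power2_commute)

text \<open>A polynomial identity in each coordinate, summed over the coordinates. It controls
  distances to any point on the line through \<open>p\<close> and \<open>q\<close>.\<close>

lemma Stewart_edist:
  "(edist d y (\<lambda>k. (1 - t) * p k + t * q k))\<^sup>2 =
    (1 - t) * (edist d y p)\<^sup>2 + t * (edist d y q)\<^sup>2 - t * (1 - t) * (edist d p q)\<^sup>2"
  unfolding edist_power2 sum_distrib_left sum.distrib[symmetric] sum_subtractf[symmetric]
  by (intro sum.cong refl) (simp add: power2_eq_square algebra_simps)

text \<open>
  The midpoint of a diametral pair gives squared radius \<open>3 D\<^sup>2 / 4\<close>, exactly the squared
  circumradius of the cube corner; moving towards a far point gains the necessary slack.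
\<close>

lemma weak_Jung:
  assumes p: "p \<in> R" and q: "q \<in> R" and pq: "edist d p q = D"
    and le: "\<And>x y. x \<in> R \<Longrightarrow> y \<in> R \<Longrightarrow> edist d x y \<le> D"
  obtains z where "\<And>y. y \<in> R \<Longrightarrow> (edist d y z)\<^sup>2 \<le> 7/10 * D\<^sup>2"
proof -
  have le2: "(edist d x y)\<^sup>2 \<le> D\<^sup>2" if "x \<in> R" "y \<in> R" for x y
    using le[OF that] edist_nonneg by (rule power_mono)
  define m where "m = (\<lambda>k. (1 - 1/2) * p k + 1/2 * q k)"
  have m: "(edist d y m)\<^sup>2 \<le> 3/4 * D\<^sup>2" if "y \<in> R" for y
    using Stewart_edist[of d y "1/2" p q] le2[OF that p] le2[OF that q] pq
    unfolding m_def by simp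
  show thesis
  proof (cases "\<forall>y\<in>R. (edist d y m)\<^sup>2 \<le> 7/10 * D\<^sup>2")
    case True
    then show thesis using that by blast
  next
    case False
    then obtain x where x: "x \<in> R" and far: "(edist d m x)\<^sup>2 > 7/10 * D\<^sup>2"
      by (auto simp: edist_commute not_le)
    \<comment> \<open>Moving the fraction t of the way from \<open>m\<close> to \<open>x\<close>
      gives the bound 3/4 - 9/20 t + 7/10 t^2 in units of D^2. Its minimum is near t = 1/3, where
      the value is 61/90 < 7/10.\<close>
    have "(edist d y (\<lambda>k. (1 - 1/3) * m k + 1/3 * x k))\<^sup>2 \<le> 7/10 * D\<^sup>2" if y: "y \<in> R" for y
    proof -
      have "(edist d y (\<lambda>k. (1 - 1/3) * m k + 1/3 * x k))\<^sup>2 =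
          2/3 * (edist d y m)\<^sup>2 + 1/3 * (edist d y x)\<^sup>2 - 2/9 * (edist d m x)\<^sup>2"
        unfolding Stewart_edist by simp
      then show ?thesis
        using m[OF y] le2[OF y x] far zero_le_power2[of D] by linarith
    qed
    then show thesis using that by blast
  qed
qed

section \<open>Points almost equidistant from a cube corner\<close>

text \<open>For \<open>e = 0\<close> the bound is the squared circumradius. The edge vectors from
  \<open>o'\<close> are orthogonal, and closeness bounds from below their inner products with
  \<open>z - o'\<close>; expanding one nonnegative square turns this into a bound on the length of
  \<open>z - o'\<close>.\<close>

lemma corner_almost_equidistant_far:
  fixes p :: "'i \<Rightarrow> nat \<Rightarrow> real"
  assumes I: "finite I"
    and edge: "\<And>i. i \<in> I \<Longrightarrow> (edist d o' (p i))\<^sup>2 = L"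
    and diag: "\<And>i j. i \<in> I \<Longrightarrow> j \<in> I \<Longrightarrow> i \<noteq> j \<Longrightarrow> (edist d (p i) (p j))\<^sup>2 = 2 * L"
    and close: "\<And>i. i \<in> I \<Longrightarrow> (edist d (p i) z)\<^sup>2 \<le> (edist d o' z)\<^sup>2 + e * L"
  shows "real (card I) * (1/4 - e/2) * L \<le> (edist d o' z)\<^sup>2"
proof -
  define ip where "ip x y = (\<Sum>k<d. x k * y k)" for x y :: "nat \<Rightarrow> real"
  define x where "x = (\<lambda>k. z k - o' k)"
  define u where "u = (\<lambda>i k. p i k - o' k)"
  have xx: "ip x x = (edist d o' z)\<^sup>2"
    unfolding edist_power2 ip_def x_def
    by (intro sum.cong) (auto simp: power2_eq_square algebra_simps)
  have ux: "2 * ip x (u i) = (edist d o' z)\<^sup>2 + (edist d o' (p i))\<^sup>2 - (edist d (p i) z)\<^sup>2" for i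
    unfolding edist_power2 ip_def x_def u_def sum_distrib_left
      sum.distrib[symmetric] sum_subtractf[symmetric]
    by (intro sum.cong) (auto simp: power2_eq_square algebra_simps)
  have uu: "2 * ip (u i) (u j) =
      (edist d o' (p i))\<^sup>2 + (edist d o' (p j))\<^sup>2 - (edist d (p i) (p j))\<^sup>2" for i j
    unfolding edist_power2 ip_def u_def sum_distrib_left
      sum.distrib[symmetric] sum_subtractf[symmetric]
    by (intro sum.cong) (auto simp: power2_eq_square algebra_simps)
  have gram: "ip (u i) (u j) = (if i = j then L else 0)" if "i \<in> I" "j \<in> I" for i j
    using uu[of i j] edge[OF that(1)] edge[OF that(2)] diag[OF that]
    by (auto simp: edist_power2)
  \<comment> \<open>Half the sum of the edge vectors is the circumcentre of the corner relative to
    \<open>o'\<close>.\<close>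
  have "0 \<le> (\<Sum>k<d. (x k - 1/2 * (\<Sum>i\<in>I. u i k))\<^sup>2)"
    by (simp add: sum_nonneg)
  also have "\<dots> = (\<Sum>k<d. x k * x k - (\<Sum>i\<in>I. x k * u i k)
      + 1/4 * (\<Sum>i\<in>I. \<Sum>j\<in>I. u i k * u j k))"
    by (intro sum.cong refl)
      (simp add: power2_eq_square algebra_simps sum_product flip: sum_distrib_left)
  also have "\<dots> = ip x x - (\<Sum>i\<in>I. ip x (u i)) + 1/4 * (\<Sum>i\<in>I. \<Sum>j\<in>I. ip (u i) (u j))"
    unfolding ip_def sum.distrib sum_subtractf sum_distrib_left[symmetric]
      sum.swap[of _ "{..<d}" I] by (simp add: sum.swap[of _ "{..<d}" I])
  also have "(\<Sum>i\<in>I. \<Sum>j\<in>I. ip (u i) (u j)) = real (card I) * L"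
    using I by (simp add: gram)
  finally have "(\<Sum>i\<in>I. ip x (u i)) \<le> ip x x + 1/4 * (real (card I) * L)"
    by simp
  \<comment> \<open>By the law of cosines \<open>ux\<close>, an upper bound on the distance from
    \<open>p i\<close> to \<open>z\<close> is a lower bound on \<open>ip x (u i)\<close>.\<close>
  moreover have "(\<Sum>i\<in>I. (1 - e) / 2 * L) \<le> (\<Sum>i\<in>I. ip x (u i))"
  proof (rule sum_mono)
    fix i assume "i \<in> I"
    then show "(1 - e) / 2 * L \<le> ip x (u i)"
      using ux[of i] edge close[of i] by (simp add: algebra_simps)
  qed
  ultimately show ?thesis
    by (simp add: xx algebra_simps)
qed

section \<open>Corners of a cube\<close>

text \<open>These inner products recover the index set from the vertex, so for \<open>s > 0\<close>
  distinct index sets give distinct vertices.\<close>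

lemma inner_cube_vertex:
  fixes w :: "'n::finite \<Rightarrow> real ^ 'n"
  assumes "\<And>i. norm (w i) = s" and "\<And>i j. i \<noteq> j \<Longrightarrow> orthogonal (w i) (w j)"
  shows "(cube_vertex a w S - a) \<bullet> w i = (if i \<in> S then s\<^sup>2 else 0)"
proof -
  have "w j \<bullet> w i = (if j = i then s\<^sup>2 else 0)" for j
    using assms(1)[of i] assms(2)[of j i] by (auto simp: orthogonal_def dot_square_norm)
  then show ?thesis
    by (simp add: cube_vertex_def inner_sum_left)
qed

text \<open>The edges leaving the vertex with index set \<open>S\<close> are \<open>w i\<close> for
  \<open>i\<close> outside \<open>S\<close> and \<open>- w i\<close> for \<open>i\<close> in
  \<open>S\<close>. Signs change neither lengths nor orthogonality, so all corners look
  alike.\<close>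

lemma cube_corner:
  fixes w :: "'n::finite \<Rightarrow> real ^ 'n"
  assumes w: "cube_frame w" and v: "v \<in> range (cube_vertex a w)"
  obtains s and u :: "'n \<Rightarrow> real ^ 'n" where "s > 0" "{u. cube_adjacent a w v u} = range u"
    "\<And>i. dist v (u i) = s" "\<And>i j. i \<noteq> j \<Longrightarrow> dist (u i) (u j) = sqrt 2 * s"
proof -
  obtain s where s: "s > 0" and nw: "\<And>i. norm (w i) = s"
    and ow: "\<And>i j. i \<noteq> j \<Longrightarrow> orthogonal (w i) (w j)"
    using w by (auto simp: cube_frame_def)
  obtain S where vS: "v = cube_vertex a w S" using v by blast
  have inj: "T = S" if "v = cube_vertex a w T" for T
  proof -
    have "i \<in> T \<longleftrightarrow> i \<in> S" for i
      using inner_cube_vertex[of w s a T i, OF nw ow] inner_cube_vertex[of w s a S i, OF nw ow]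
        that vS s by (auto split: if_splits)
    then show ?thesis by blast
  qed
  have ins: "cube_vertex a w (insert i T) = cube_vertex a w T + w i" if "i \<notin> T" for i T
    using that by (simp add: cube_vertex_def)
  define \<sigma> :: "'n \<Rightarrow> real" where "\<sigma> i = (if i \<in> S then -1 else 1)" for i
  define u where "u i = v + \<sigma> i *\<^sub>R w i" for i
  show thesis
  proof
    show "s > 0" by fact
    show "{u. cube_adjacent a w v u} = range u"
    proof (intro equalityI subsetI)
      fix y assume "y \<in> {u. cube_adjacent a w v u}"
      then obtain T i where i: "i \<notin> T"
        and "{v, y} = {cube_vertex a w T, cube_vertex a w (insert i T)}"
        by (auto simp: cube_adjacent_def)
      then consider "v = cube_vertex a w T" "y = cube_vertex a w (insert i T)"
        | "v = cube_vertex a w (insert i T)" "y = cube_vertex a w T"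
        by (auto simp: doubleton_eq_iff)
      then have "y = u i"
      proof cases
        case 1
        then show ?thesis using inj[OF 1(1)] i ins[OF i] by (simp add: u_def \<sigma>_def)
      next
        case 2
        then have "i \<in> S" using inj[OF 2(1)] by blast
        then show ?thesis using 2 ins[OF i] by (simp add: u_def \<sigma>_def)
      qed
      then show "y \<in> range u" by blast
    next
      fix y assume "y \<in> range u"
      then obtain i where y: "y = u i" by blast
      show "y \<in> {u. cube_adjacent a w v u}"
      proof (cases "i \<in> S")
        case True
        have "insert i (S - {i}) = S" using True by blast
        then have "v = cube_vertex a w (insert i (S - {i}))" "y = cube_vertex a w (S - {i})"
          using ins[of i "S - {i}"] True by (simp_all add: y u_def \<sigma>_def vS)
        then show ?thesis
          unfolding cube_adjacent_def by blast
      next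
        case False
        then have "y = cube_vertex a w (insert i S)"
          using ins[of i S] by (simp add: y u_def \<sigma>_def vS)
        then show ?thesis
          using False vS unfolding cube_adjacent_def by blast
      qed
    qed
    show "dist v (u i) = s" for i
      by (simp add: u_def dist_norm nw \<sigma>_def)
    show "dist (u i) (u j) = sqrt 2 * s" if "i \<noteq> j" for i j
    proof -
      from that have "orthogonal (\<sigma> i *\<^sub>R w i) (- (\<sigma> j *\<^sub>R w j))"
        using ow by (simp add: orthogonal_def)
      then have "(norm (\<sigma> i *\<^sub>R w i + - (\<sigma> j *\<^sub>R w j)))\<^sup>2 = s\<^sup>2 + s\<^sup>2"
        by (subst norm_add_Pythagorean) (auto simp: nw \<sigma>_def)
      then have "(dist (u i) (u j))\<^sup>2 = (sqrt 2 * s)\<^sup>2"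
        by (simp add: u_def dist_norm power_mult_distrib)
      then show "dist (u i) (u j) = sqrt 2 * s"
        using s by simp
    qed
  qed
qed

section \<open>Diameters and rounding\<close>

lemma diam_wrt_ge:
  assumes "finite X" "x \<in> X" "y \<in> X"
  shows "\<delta> x y \<le> diam_wrt \<delta> X"
proof -
  have "finite {\<delta> x y | x y. x \<in> X \<and> y \<in> X}"
    using assms(1) by (simp add: finite_image_set2)
  then show ?thesis
    unfolding diam_wrt_def using assms by (intro Max_ge) auto
qed

lemma diam_wrt_attained:
  assumes "finite X" "X \<noteq> {}"
  obtains x y where "x \<in> X" "y \<in> X" "\<delta> x y = diam_wrt \<delta> X"
proof -
  have "finite {\<delta> x y | x y. x \<in> X \<and> y \<in> X}"
    using assms(1) by (simp add: finite_image_set2)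
  then have "diam_wrt \<delta> X \<in> {\<delta> x y | x y. x \<in> X \<and> y \<in> X}"
    unfolding diam_wrt_def using assms by (intro Max_in) auto
  then show thesis using that by auto
qed

text \<open>Both values lie in the same cell of width \<open>e\<close>. Nonnegativity matters
  because \<open>nat\<close> sends every negative floor to 0.\<close>

lemma floor_divide_eq_imp_less:
  fixes x y e :: real
  assumes "nat \<lfloor>x / e\<rfloor> = nat \<lfloor>y / e\<rfloor>" "0 \<le> x" "0 \<le> y" "e > 0"
  shows "y < x + e"
proof -
  have "\<lfloor>x / e\<rfloor> = \<lfloor>y / e\<rfloor>"
    using assms by (simp add: eq_nat_nat_iff)
  then have "y / e < x / e + 1"
    by linarith
  then show ?thesis
    using assms(4) by (simp add: field_simps)
qed

section \<open>The colouring argument\<close>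

text \<open>In dimension n the squared circumradius is n s^2 / 4, while the enclosing ball keeps
  squared radius 14/10 s^2; so one argument covers all n \<ge> 6.\<close>

theorem cube_corner_not_diameter_Ramsey:
  fixes a v :: "real ^ 'n::finite"
  assumes n: "CARD('n) \<ge> 6" and w: "cube_frame w" and v: "v \<in> range (cube_vertex a w)"
  shows "\<not> diameter_Ramsey (insert v {u. cube_adjacent a w v u})"
proof
  obtain s and u :: "'n \<Rightarrow> real ^ 'n" where s: "s > 0" and adj: "{u. cube_adjacent a w v u} = range u"
    and edge: "\<And>i. dist v (u i) = s"
    and diag: "\<And>i j. i \<noteq> j \<Longrightarrow> dist (u i) (u j) = sqrt 2 * s"
    by (rule cube_corner[OF w v]) (rule that)
  define P where "P = insert v (range u)"
  assume "diameter_Ramsey (insert v {u. cube_adjacent a w v u})"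
  then have "diameter_Ramsey P"
    by (simp add: P_def adj)
  then have "\<exists>d R. finite R \<and> R \<subseteq> topspace (Euclidean_space d) \<and>
      diam_wrt (edist d) R = diam_wrt dist P \<and>
      (\<forall>c \<in> R \<rightarrow> {..<48::nat}. \<exists>Q\<subseteq>R.
         (\<exists>k. \<forall>x\<in>Q. c x = k) \<and> congruent_wrt dist P (edist d) Q)"
    unfolding diameter_Ramsey_def by simp
  then obtain d R where R: "finite R" and dR: "diam_wrt (edist d) R = diam_wrt dist P"
    and mono: "\<And>c. c \<in> R \<rightarrow> {..<48::nat} \<Longrightarrow>
      \<exists>Q\<subseteq>R. (\<exists>k. \<forall>x\<in>Q. c x = k) \<and> congruent_wrt dist P (edist d) Q"
    by blast
  have "finite P" by (simp add: P_def)
  have "s \<le> sqrt 2 * s" using s by simp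
  moreover have "dist (u i) (u j) \<le> sqrt 2 * s" for i j
    using diag[of i j] s by (cases "i = j") auto
  ultimately have P_le: "dist x y \<le> sqrt 2 * s" if "x \<in> P" "y \<in> P" for x y
    using that s edge unfolding P_def by (auto simp: dist_commute[of "u _" v])
  obtain x y where "x \<in> P" "y \<in> P" "dist x y = diam_wrt dist P"
    using diam_wrt_attained[OF \<open>finite P\<close>] by (metis P_def insert_not_empty)
  with P_le have "diam_wrt dist P \<le> sqrt 2 * s" by metis
  moreover have "0 \<le> diam_wrt dist P"
    using diam_wrt_ge[OF \<open>finite P\<close>, of v v dist] by (simp add: P_def)
  ultimately have D: "(diam_wrt dist P)\<^sup>2 \<le> 2 * s\<^sup>2"
    using power_mono[of "diam_wrt dist P" "sqrt 2 * s" 2] by (simp add: power_mult_distrib)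
  obtain z where z: "\<And>y. y \<in> R \<Longrightarrow> (edist d y z)\<^sup>2 \<le> 14/10 * s\<^sup>2"
  \<comment> \<open>\<open>Max\<close> of the empty set is unspecified, so a diametral pair is
    available only for nonempty \<open>R\<close>.\<close>
  proof (cases "R = {}")
    case True
    then show thesis using that by blast
  next
    case False
    then obtain p q where pq: "p \<in> R" "q \<in> R" "edist d p q = diam_wrt (edist d) R"
      using diam_wrt_attained[OF R] by metis
    obtain z where "\<And>y. y \<in> R \<Longrightarrow> (edist d y z)\<^sup>2 \<le> 7/10 * (diam_wrt (edist d) R)\<^sup>2"
      using weak_Jung[OF pq diam_wrt_ge[OF R]] by blast
    then have "(edist d y z)\<^sup>2 \<le> 14/10 * s\<^sup>2" if "y \<in> R" for y
      using D that unfolding dR by fastforce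
    then show thesis using that by blast
  qed
  \<comment> \<open>A contradiction needs 6 (1/4 - e / (2 s^2)) > 14/10, that is, a width below s^2
    / 30.\<close>
  define e where "e = 3/100 * s\<^sup>2"
  have e: "e > 0" using s by (simp add: e_def)
  define c where "c x = nat \<lfloor>(edist d x z)\<^sup>2 / e\<rfloor>" for x
  have "c x < 48" if "x \<in> R" for x
  proof -
    \<comment> \<open>48 cells of width \<open>e\<close> reach 1.44 s^2, beyond the ball's 1.4
      s^2.\<close>
    have "(edist d x z)\<^sup>2 < 48 * e"
      using z[OF that] e unfolding e_def by linarith
    then have "(edist d x z)\<^sup>2 / e < 48"
      using e by (simp add: pos_divide_less_eq)
    then show ?thesis
      unfolding c_def by linarith
  qed
  then have "c \<in> R \<rightarrow> {..<48}" by auto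
  from mono[OF this] obtain Q k f where Q: "Q \<subseteq> R" "\<And>x. x \<in> Q \<Longrightarrow> c x = k"
    and f: "bij_betw f P Q" "\<And>x y. x \<in> P \<Longrightarrow> y \<in> P \<Longrightarrow> edist d (f x) (f y) = dist x y"
    unfolding congruent_wrt_def by blast
  have fQ: "f v \<in> Q" "f (u i) \<in> Q" for i
    using f(1) by (auto simp: P_def bij_betw_def)
  have "real (card (UNIV :: 'n set)) * (1/4 - (3/100)/2) * s\<^sup>2 \<le> (edist d (f v) z)\<^sup>2"
  proof (rule corner_almost_equidistant_far)
    show "(edist d (f v) (f (u i)))\<^sup>2 = s\<^sup>2" for i
      by (simp add: f(2) P_def edge)
    show "(edist d (f (u i)) (f (u j)))\<^sup>2 = 2 * s\<^sup>2" if "i \<noteq> j" for i j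
      by (simp add: f(2) P_def diag[OF that] power_mult_distrib)
    show "(edist d (f (u i)) z)\<^sup>2 \<le> (edist d (f v) z)\<^sup>2 + 3/100 * s\<^sup>2" for i
    proof -
      have "c (f v) = c (f (u i))" using Q(2) fQ by metis
      then have "(edist d (f (u i)) z)\<^sup>2 < (edist d (f v) z)\<^sup>2 + e"
        unfolding c_def by (rule floor_divide_eq_imp_less) (use e in auto)
      then show ?thesis by (simp add: e_def)
    qed
  qed auto
  moreover have "(edist d (f v) z)\<^sup>2 \<le> 14/10 * s\<^sup>2"
    using z Q(1) fQ(1) by blast
  moreover have "6 * (1/4 - (3/100)/2) * s\<^sup>2 \<le> real CARD('n) * (1/4 - (3/100)/2) * s\<^sup>2"
    using n by (intro mult_right_mono) auto
  moreover have "0 < s\<^sup>2" using s by simp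
  \<comment> \<open>The lower bound is 1.41 s^2, the upper bound 1.4 s^2.\<close>
  ultimately show False by simp
qed

theorem theorem5:
  fixes a v :: "real ^ 6" and w :: "6 \<Rightarrow> real ^ 6" and P :: "(real ^ 6) set"
  assumes "cube_frame w"
    and "v \<in> range (cube_vertex a w)"
    and "P = insert v {u. cube_adjacent a w v u}"
  shows "\<not> diameter_Ramsey P"
  unfolding assms(3) using assms(1,2) by (intro cube_corner_not_diameter_Ramsey) simp_all

end
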